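(* Let $G_o$ be a unimodular lcsc group acting jointly continuously on Polish spaces $X_1,\dots,X_r$ with separated cross sections $Z_1,\dots,Z_r$ and return time sets $\Lambda_1,\dots,\Lambda_r\subset G_o$ respectively. The cross sections $Z_1,\dots,Z_r$ are commensurable provided the intersection $\Lambda:=\Lambda_1\cap\dots\cap\Lambda_r$ is relatively dense in $G_o$ and none of the product sets $\Lambda_i^3\Lambda_j^3$ ($i,j\in\{1,\dots,r\}$) accumulates at the identity.
   Context: lcsc = locally compact second countable. For a Borel action of an lcsc group $H$ on a standard Borel space $S$, a Borel set $T\subset S$ is a cross section if $H.T=S$; its return time set is $\{h\in H: h.T\cap T\ne\emptyset\}$; it is separated if its return time set meets some identity neighbourhood of $H$ only in $e$. Put $X:=X_1\times\dots\times X_r$, with the product action of $G_o^r$, and $X^{[r]}:=\{(x_1,\dots,x_r)\in X:\exists g\in G_o:\ g.x_1\in Z_1,\dots,g.x_r\in Z_r\}$, a Borel subset of $X$. For $k\in\{1,\dots,r\}$ let $N_k<G_o^r$ be the kernel of the $k$-th coordinate projection. $Z_1,\dots,Z_r$ are called commensurable if $X^{[r]}$ is a separated cross section for the $N_k$-action on $X$ for every $k\in\{1,\dots,r\}$. $A\subset G_o$ is relatively dense if $G_o=KA$ for some compact $K\subset G_o$. $A\subset G_o$ does not accumulate at the identity if $A\cap U\subset\{e\}$ for some identity neighbourhood $U$. $A^3$ is the threefold product set $AAA$, and $AB=\{ab:a\in A,b\in B\}$. *)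

theory Defs
  imports
    "HOL-Analysis.Analysis"
    "HOL-Algebra.Group_Action"
    "HOL-Algebra.Product_Groups"
begin

section \<open>Topological and measurable preliminaries\<close>

definition borel_of :: "'a topology \<Rightarrow> 'a measure"
  where "borel_of T = sigma (topspace T) {U. openin T U}"

definition polish_space :: "'a topology \<Rightarrow> bool"
  where "polish_space T \<longleftrightarrow> completely_metrizable_space T \<and> separable_space T"

text \<open>A topological group is a group on an arbitrary carrier with a separate topology on that
  carrier; dealing with carriers is what makes subgroups of powers of the group available.\<close>

locale topological_group = group G for G (structure) and T :: "'g topology" +
  assumes topspace_carrier: "topspace T = carrier G"
    and continuous_mult: "continuous_map (prod_topology T T) T (\<lambda>(x, y). x \<otimes> y)"
    and continuous_inv: "continuous_map T T (\<lambda>x. inv x)"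

locale lcsc_group = topological_group +
  assumes hausdorff: "Hausdorff_space T"
    and locally_compact: "locally_compact_space T"
    and second_countable: "second_countable T"

text \<open>On an lcsc group every Borel measure that is finite on compact sets is regular, so no
  regularity condition is needed here.\<close>

definition left_haar_measure ::
    "('g, 'm) monoid_scheme \<Rightarrow> 'g topology \<Rightarrow> 'g measure \<Rightarrow> bool"
  where "left_haar_measure G T \<mu> \<longleftrightarrow>
    sets \<mu> = sets (borel_of T) \<and>
    (\<forall>K. compactin T K \<longrightarrow> emeasure \<mu> K < \<infinity>) \<and>
    (\<forall>U. openin T U \<and> U \<noteq> {} \<longrightarrow> emeasure \<mu> U > 0) \<and>
    (\<forall>g\<in>carrier G. \<forall>A\<in>sets \<mu>. emeasure \<mu> (g <#\<^bsub>G\<^esub> A) = emeasure \<mu> A)"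

definition unimodular :: "('g, 'm) monoid_scheme \<Rightarrow> 'g topology \<Rightarrow> bool"
  where "unimodular G T \<longleftrightarrow>
    (\<exists>\<mu>. left_haar_measure G T \<mu> \<and>
         (\<forall>g\<in>carrier G. \<forall>A\<in>sets \<mu>. emeasure \<mu> (A #>\<^bsub>G\<^esub> g) = emeasure \<mu> A))"

section \<open>Subsets of a topological group\<close>

definition relatively_dense :: "('g, 'm) monoid_scheme \<Rightarrow> 'g topology \<Rightarrow> 'g set \<Rightarrow> bool"
  where "relatively_dense G T A \<longleftrightarrow> (\<exists>K. compactin T K \<and> carrier G = K <#>\<^bsub>G\<^esub> A)"

definition accumulates_at_one :: "('g, 'm) monoid_scheme \<Rightarrow> 'g topology \<Rightarrow> 'g set \<Rightarrow> bool"
  where "accumulates_at_one G T A \<longleftrightarrow>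
    \<not> (\<exists>U. openin T U \<and> \<one>\<^bsub>G\<^esub> \<in> U \<and> A \<inter> U \<subseteq> {\<one>\<^bsub>G\<^esub>})"

section \<open>Cross sections\<close>

text \<open>The notions below are meant for a Borel action of an lcsc group on a standard Borel space
  \<open>M\<close>. The acting group enters only through its carrier, so the action of a subgroup is
  given by the same map \<open>act\<close>.\<close>

definition cross_section ::
    "('g, 'm) monoid_scheme \<Rightarrow> ('g \<Rightarrow> 'x \<Rightarrow> 'x) \<Rightarrow> 'x measure \<Rightarrow> 'x set \<Rightarrow> bool"
  where "cross_section H act M Z \<longleftrightarrow>
    Z \<in> sets M \<and> (\<Union>h\<in>carrier H. act h ` Z) = space M"

definition return_times ::
    "('g, 'm) monoid_scheme \<Rightarrow> ('g \<Rightarrow> 'x \<Rightarrow> 'x) \<Rightarrow> 'x set \<Rightarrow> 'g set"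
  where "return_times H act Z = {h \<in> carrier H. act h ` Z \<inter> Z \<noteq> {}}"

definition separated_cross_section ::
    "('g, 'm) monoid_scheme \<Rightarrow> 'g topology \<Rightarrow> ('g \<Rightarrow> 'x \<Rightarrow> 'x) \<Rightarrow> 'x measure \<Rightarrow> 'x set \<Rightarrow> bool"
  where "separated_cross_section H T act M Z \<longleftrightarrow>
    cross_section H act M Z \<and> \<not> accumulates_at_one H T (return_times H act Z)"

section \<open>Commensurable families\<close>

text \<open>Finite products are indexed by a set \<open>I\<close> and realised as extensional functions, matching
  \<^const>\<open>product_topology\<close> and \<^const>\<open>product_group\<close>.\<close>

definition product_action ::
    "'i set \<Rightarrow> ('i \<Rightarrow> 'x set) \<Rightarrow> ('i \<Rightarrow> 'g \<Rightarrow> 'x \<Rightarrow> 'x) \<Rightarrow> ('i \<Rightarrow> 'g) \<Rightarrow> ('i \<Rightarrow> 'x) \<Rightarrow> ('i \<Rightarrow> 'x)"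
  where "product_action I E act g = (\<lambda>x\<in>(\<Pi>\<^sub>E i\<in>I. E i). \<lambda>i\<in>I. act i (g i) (x i))"

definition simultaneous_returns ::
    "('g, 'm) monoid_scheme \<Rightarrow> 'i set \<Rightarrow> ('i \<Rightarrow> 'x topology) \<Rightarrow> ('i \<Rightarrow> 'g \<Rightarrow> 'x \<Rightarrow> 'x) \<Rightarrow>
      ('i \<Rightarrow> 'x set) \<Rightarrow> ('i \<Rightarrow> 'x) set"
  where "simultaneous_returns G I X act Z =
    {x \<in> topspace (product_topology X I). \<exists>g\<in>carrier G. \<forall>i\<in>I. act i g (x i) \<in> Z i}"

definition coordinate_kernel :: "('g, 'm) monoid_scheme \<Rightarrow> 'i set \<Rightarrow> 'i \<Rightarrow> ('i \<Rightarrow> 'g) set"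
  where "coordinate_kernel G I k = kernel (product_group I (\<lambda>_. G)) G (\<lambda>g. g k)"

definition commensurable ::
    "('g, 'm) monoid_scheme \<Rightarrow> 'g topology \<Rightarrow> 'i set \<Rightarrow> ('i \<Rightarrow> 'x topology) \<Rightarrow>
      ('i \<Rightarrow> 'g \<Rightarrow> 'x \<Rightarrow> 'x) \<Rightarrow> ('i \<Rightarrow> 'x set) \<Rightarrow> bool"
  where "commensurable G T I X act Z \<longleftrightarrow>
    (\<forall>k\<in>I. separated_cross_section
      ((product_group I (\<lambda>_. G))\<lparr>carrier := coordinate_kernel G I k\<rparr>)
      (subtopology (product_topology (\<lambda>_. T) I) (coordinate_kernel G I k))
      (product_action I (\<lambda>i. topspace (X i)) act)
      (borel_of (product_topology X I))
      (simultaneous_returns G I X act Z))"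

end

theory Submission
  imports Defs
begin

text \<open>The cross section property is immediate: move every \<open>x\<^sub>i\<close> into \<open>Z\<^sub>i\<close> by some
  \<open>g\<^sub>i\<close> and act by the tuple of the \<open>g\<^sub>k\<inverse> g\<^sub>i\<close>.
  For separation, a return time \<open>n\<close> with \<open>n\<^sub>k = e\<close> satisfies
  \<open>n\<^sub>i = h\<inverse> a b\<inverse> h\<close> with \<open>a \<in> \<Lambda>\<^sub>i\<close>, \<open>b \<in> \<Lambda>\<^sub>k\<close> and \<open>h\<close> arbitrary. Relative density of the
  common return times allows to write \<open>h\<inverse> = \<kappa> l\<close> with \<open>\<kappa>\<close> in a compact set and
  \<open>l \<in> \<Lambda>\<^sub>i \<inter> \<Lambda>\<^sub>k\<close>, so that \<open>\<kappa>\<inverse> n\<^sub>i \<kappa> \<in> \<Lambda>\<^sub>i\<^sup>2 \<Lambda>\<^sub>k\<^sup>2\<close>. As conjugation by a compact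
  set distorts identity neighbourhoods in a controlled way, \<open>n\<^sub>i\<close> close to \<open>e\<close> forces \<open>n\<^sub>i = e\<close>.
  The real work is that \<open>X\<^sup>[\<^sup>r\<^sup>]\<close> is Borel: it and its complement are projections of Borel sets
  of a Polish space, hence analytic, and Lusin's separation theorem applies.\<close>

section \<open>Borel sets of a topology\<close>

lemma space_borel_of [simp]: "space (borel_of X) = topspace X"
  unfolding borel_of_def by (rule space_measure_of) (auto dest: openin_subset)

lemma sets_borel_of: "sets (borel_of X) = sigma_sets (topspace X) {U. openin X U}"
  unfolding borel_of_def by (rule sets_measure_of) (auto dest: openin_subset)

lemma openin_imp_sets_borel_of: "openin X U \<Longrightarrow> U \<in> sets (borel_of X)"
  by (simp add: sets_borel_of sigma_sets.Basic)

lemma continuous_map_imp_measurable: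
  assumes "continuous_map X Y f"
  shows "f \<in> measurable (borel_of X) (borel_of Y)"
proof (rule measurable_sigma_sets[OF sets_borel_of])
  show "{U. openin Y U} \<subseteq> Pow (topspace Y)"
    by (auto dest: openin_subset)
  show "f \<in> space (borel_of X) \<rightarrow> topspace Y"
    using assms by (auto simp: continuous_map_def)
  show "f -` U \<inter> space (borel_of X) \<in> sets (borel_of X)" if "U \<in> {U. openin Y U}" for U
    using openin_continuous_map_preimage[OF assms, of U] that
    by (auto intro!: openin_imp_sets_borel_of simp: Int_def vimage_def conj_commute)
qed

section \<open>Analytic sets\<close>

text \<open>Closed subsets of Baire space, rather than the whole space, are admitted as parameter sets, so
  that \<open>{}\<close> is analytic and no retraction onto them is needed.\<close>

definition analytic_in :: "'a topology \<Rightarrow> 'a set \<Rightarrow> bool"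
  where "analytic_in X A \<longleftrightarrow>
    (\<exists>C (f :: (nat \<Rightarrow> nat) \<Rightarrow> 'a). closed C \<and> continuous_map (top_of_set C) X f \<and> A = f ` C)"

lemma analytic_in_continuous_map_image:
  assumes "analytic_in X A" "continuous_map X Y p"
  shows "analytic_in Y (p ` A)"
proof -
  obtain C and f :: "(nat \<Rightarrow> nat) \<Rightarrow> _" where "closed C" "continuous_map (top_of_set C) X f" "A = f ` C"
    using assms(1) unfolding analytic_in_def by blast
  then show ?thesis
    unfolding analytic_in_def
    by (intro exI[of _ C] exI[of _ "p \<circ> f"])
      (auto intro: continuous_map_compose[OF _ assms(2)] simp: image_comp)
qed

text \<open>The parameters mapped into \<open>F\<close> form a closed set again, so the same map
  parametrises the intersection.\<close>

lemma analytic_in_Int_closedin: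
  assumes "analytic_in X A" "closedin X F"
  shows "analytic_in X (A \<inter> F)"
proof -
  obtain C and f :: "(nat \<Rightarrow> nat) \<Rightarrow> _" where C: "closed C" "continuous_map (top_of_set C) X f" "A = f ` C"
    using assms(1) unfolding analytic_in_def by blast
  have "closedin (top_of_set C) {s \<in> C. f s \<in> F}"
    using closedin_continuous_map_preimage[OF C(2) assms(2)] by simp
  then have "closed {s \<in> C. f s \<in> F}"
    using C(1) closedin_closed_trans by blast
  moreover have "continuous_map (top_of_set {s \<in> C. f s \<in> F}) X f"
    using C(2) by (rule continuous_map_from_subtopology_mono) auto
  ultimately show ?thesis
    unfolding analytic_in_def using C(3) by blast
qed

text \<open>The first coordinate of a sequence selects the index \<open>n\<close>, and the shifted
  remainder serves as a parameter for \<open>A n\<close>.\<close>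

lemma analytic_in_UN:
  fixes A :: "nat \<Rightarrow> 'a set"
  assumes "\<And>n. analytic_in X (A n)"
  shows "analytic_in X (\<Union>n. A n)"
proof -
  obtain C and f :: "nat \<Rightarrow> (nat \<Rightarrow> nat) \<Rightarrow> 'a" where
    C: "\<And>n. closed (C n)" "\<And>n. continuous_map (top_of_set (C n)) X (f n)" "\<And>n. A n = f n ` C n"
    using assms unfolding analytic_in_def by metis
  define tl :: "(nat \<Rightarrow> nat) \<Rightarrow> nat \<Rightarrow> nat" where "tl s = (\<lambda>k. s (Suc k))" for s
  have tl: "continuous_on UNIV tl"
    unfolding tl_def by (intro continuous_on_coordinatewise_then_product continuous_on_product_coordinates)
  have hd: "open ((\<lambda>s. s 0) -` V)" for V :: "nat set"
    by (intro open_vimage open_discrete continuous_on_product_coordinates)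
  define D where "D = {s. tl s \<in> C (s 0)}"
  define g where "g s = f (s 0) (tl s)" for s
  \<comment> \<open>Rewrites \<open>D\<close> as countably many implications: if the head is
    \<open>n\<close>, then the tail lies in \<open>C n\<close>. Each is a closed condition because
    prescribing the head is an open one.\<close>
  have D_alt: "D = (\<Inter>n. - ((\<lambda>s. s 0) -` {n}) \<union> tl -` C n)"
    by (auto simp: D_def)
  have "closed (- ((\<lambda>s. s 0) -` {n}) \<union> tl -` C n)" for n
    using closed_vimage[OF C(1) tl] hd by (intro closed_Un closed_Compl) auto
  then have "closed D"
    unfolding D_alt by blast
  moreover have "continuous_map (top_of_set D) X g"
  proof (rule pasting_lemma[where I = UNIV and T = "\<lambda>n. D \<inter> (\<lambda>s. s 0) -` {n}" and f = "\<lambda>n. f n \<circ> tl"])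
    show "openin (top_of_set D) (D \<inter> (\<lambda>s. s 0) -` {n})" for n
      using hd by blast
    have "continuous_map (top_of_set (D \<inter> (\<lambda>s. s 0) -` {n})) (top_of_set (C n)) tl" for n
      using continuous_on_subset[OF tl] by (auto simp: D_def)
    then show "continuous_map (subtopology (top_of_set D) (D \<inter> (\<lambda>s. s 0) -` {n})) X (f n \<circ> tl)" for n
      unfolding subtopology_subtopology using continuous_map_compose[OF _ C(2)] by (metis inf.left_idem)
  qed (auto simp: g_def)
  moreover have "g ` D = (\<Union>n. A n)"
  proof
    show "g ` D \<subseteq> (\<Union>n. A n)"
      unfolding g_def D_def C(3) by blast
    show "(\<Union>n. A n) \<subseteq> g ` D"
    proof
      fix x assume "x \<in> (\<Union>n. A n)"
      then obtain n s where "s \<in> C n" "x = f n s" unfolding C(3) by blast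
      then have "case_nat n s \<in> D" "x = g (case_nat n s)"
        by (auto simp: D_def g_def tl_def)
      then show "x \<in> g ` D" by blast
    qed
  qed
  ultimately show ?thesis unfolding analytic_in_def by blast
qed

text \<open>One sequence codes countably many through the pairing function, and row \<open>n\<close>
  is a parameter for \<open>A n\<close>. Requiring all rows to have the same image is a closed
  condition since \<open>X\<close> is Hausdorff.\<close>

lemma analytic_in_INT:
  fixes A :: "nat \<Rightarrow> 'a set"
  assumes "Hausdorff_space X" "\<And>n. analytic_in X (A n)"
  shows "analytic_in X (\<Inter>n. A n)"
proof -
  obtain C and f :: "nat \<Rightarrow> (nat \<Rightarrow> nat) \<Rightarrow> 'a" where
    C: "\<And>n. closed (C n)" "\<And>n. continuous_map (top_of_set (C n)) X (f n)" "\<And>n. A n = f n ` C n"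
    using assms unfolding analytic_in_def by metis
  define row :: "nat \<Rightarrow> (nat \<Rightarrow> nat) \<Rightarrow> nat \<Rightarrow> nat" where "row n s = (\<lambda>k. s (prod_encode (n, k)))" for n s
  have row: "continuous_on UNIV (row n)" for n
    unfolding row_def by (intro continuous_on_coordinatewise_then_product continuous_on_product_coordinates)
  define D where "D = (\<Inter>n. row n -` C n)"
  have "closed D"
    unfolding D_def by (intro closed_INT ballI closed_vimage C row)
  have g: "continuous_map (top_of_set D) X (f n \<circ> row n)" for n
  proof (rule continuous_map_compose[OF _ C(2)])
    show "continuous_map (top_of_set D) (top_of_set (C n)) (row n)"
      using continuous_on_subset[OF row] by (auto simp: D_def)
  qed
  define E where "E = (\<Inter>n. {s \<in> D. f n (row n s) = f 0 (row 0 s)})"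
  have "closedin (top_of_set D) E"
    unfolding E_def using closedin_continuous_maps_eq[OF assms(1) g g]
    by (intro closedin_INT) auto
  then have "closed E"
    using \<open>closed D\<close> closedin_closed_trans by blast
  moreover have "continuous_map (top_of_set E) X (f 0 \<circ> row 0)"
    using g by (rule continuous_map_from_subtopology_mono) (auto simp: E_def)
  moreover have "(f 0 \<circ> row 0) ` E = (\<Inter>n. A n)"
  proof
    show "(f 0 \<circ> row 0) ` E \<subseteq> (\<Inter>n. A n)"
    proof clarify
      fix s n assume "s \<in> E"
      then have "row n s \<in> C n" "f n (row n s) = f 0 (row 0 s)"
        by (auto simp: E_def D_def)
      then show "(f 0 \<circ> row 0) s \<in> A n" by (metis C(3) comp_apply imageI)
    qed
    show "(\<Inter>n. A n) \<subseteq> (f 0 \<circ> row 0) ` E"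
    proof
      fix x assume "x \<in> (\<Inter>n. A n)"
      then have "\<forall>n. \<exists>s\<in>C n. x = f n s" unfolding C(3) by blast
      then obtain s where s: "\<And>n. s n \<in> C n" "\<And>n. x = f n (s n)" by metis
      define t where "t m = (case prod_decode m of (n, k) \<Rightarrow> s n k)" for m
      have "row n t = s n" for n by (simp add: row_def t_def)
      then have "t \<in> E" "x = f 0 (row 0 t)" using s by (auto simp: E_def D_def)
      then show "x \<in> (f 0 \<circ> row 0) ` E" by auto
    qed
  qed
  ultimately show ?thesis unfolding analytic_in_def by blast
qed

section \<open>Borel subsets of Polish spaces are analytic\<close>

lemma polish_space_imp_Hausdorff_space: "polish_space X \<Longrightarrow> Hausdorff_space X"
  unfolding polish_space_def
  by (blast intro: completely_metrizable_imp_metrizable_space metrizable_imp_Hausdorff_space)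

text \<open>Points are coded by index sequences into a countable dense set that converge at the
  explicit rate \<open>b\<close>. The codes form a closed set, the limit depends continuously on the
  code, and every point is such a limit.\<close>

lemma analytic_in_topspace:
  assumes "polish_space X"
  shows "analytic_in X (topspace X)"
proof (cases "topspace X = {}")
  case True
  then show ?thesis
    unfolding analytic_in_def by (intro exI[of _ "{}"]) (auto simp: continuous_map_def)
next
  case False
  obtain M d where M: "Metric_space M d" "Metric_space.mcomplete M d" "X = Metric_space.mtopology M d"
    using assms unfolding polish_space_def completely_metrizable_space_def by blast
  interpret Metric_space M d by fact
  obtain S where S: "countable S" "S \<subseteq> M" "X closure_of S = M"
    using assms M(3) unfolding polish_space_def separable_space_def by auto
  then have "S \<noteq> {}" using False M(3) by auto
  define e where "e = from_nat_into S"
  have e: "e n \<in> M" for n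
    using from_nat_into[OF \<open>S \<noteq> {}\<close>] S(2) by (auto simp: e_def)
  define b :: "nat \<Rightarrow> real" where "b n = inverse (real (Suc n))" for n
  have b: "b \<longlonglongrightarrow> 0" unfolding b_def by (rule LIMSEQ_inverse_real_of_nat)
  have b_pos: "b n > 0" for n by (simp add: b_def)
  \<comment> \<open>The bound is what the triangle inequality gives when each \<open>e (s m)\<close>
    lies within \<open>b m\<close> of one point; conversely it forces the Cauchy property. It reads
    two coordinates at a time, hence is closed.\<close>
  define C :: "(nat \<Rightarrow> nat) set" where "C = {s. \<forall>m n. d (e (s m)) (e (s n)) \<le> b m + b n}"
  have "closed C"
  proof -
    have "open {s :: nat \<Rightarrow> nat. \<not> d (e (s m)) (e (s n)) \<le> b m + b n}" for m n
    proof -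
      have "{s :: nat \<Rightarrow> nat. \<not> d (e (s m)) (e (s n)) \<le> b m + b n} =
        (\<Union>i. \<Union>j\<in>{j. \<not> d (e i) (e j) \<le> b m + b n}. (\<lambda>s. s m) -` {i} \<inter> (\<lambda>s. s n) -` {j})"
        by auto
      also have "open \<dots>"
        by (intro open_UN ballI open_Int open_vimage open_discrete continuous_on_product_coordinates)
      finally show ?thesis .
    qed
    then have "closed {s :: nat \<Rightarrow> nat. d (e (s m)) (e (s n)) \<le> b m + b n}" for m n
      unfolding closed_def by (simp add: Collect_neg_eq)
    then show ?thesis
      unfolding C_def by (intro closed_Collect_all)
  qed
  have "\<exists>x\<in>M. \<forall>m. d (e (s m)) x \<le> b m" if "s \<in> C" for s
  proof -
    have "MCauchy (\<lambda>n. e (s n))"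
      unfolding MCauchy_def
    proof (intro conjI allI impI)
      show "range (\<lambda>n. e (s n)) \<subseteq> M" using e by auto
      fix \<epsilon> :: real assume "\<epsilon> > 0"
      then have "eventually (\<lambda>n. b n < \<epsilon> / 2) sequentially"
        using b by (intro order_tendstoD(2)) auto
      then obtain N where N: "\<And>n. n \<ge> N \<Longrightarrow> b n < \<epsilon> / 2"
        by (auto simp: eventually_sequentially)
      show "\<exists>N. \<forall>n n'. N \<le> n \<longrightarrow> N \<le> n' \<longrightarrow> d (e (s n)) (e (s n')) < \<epsilon>"
      proof (intro exI allI impI)
        fix n n' assume "N \<le> n" "N \<le> n'"
        then show "d (e (s n)) (e (s n')) < \<epsilon>"
          using N[of n] N[of n'] that[unfolded C_def] by (smt (verit) field_sum_of_halves mem_Collect_eq)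
      qed
    qed
    then obtain x where x: "limitin mtopology (\<lambda>n. e (s n)) x sequentially"
      using M(2) by (auto simp: mcomplete_def)
    then have "x \<in> M" and lim: "(\<lambda>n. d (e (s n)) x) \<longlonglongrightarrow> 0"
      by (auto simp: limitin_metric_dist_null)
    have "d (e (s m)) x \<le> b m" for m
    proof (rule LIMSEQ_le_const)
      show "(\<lambda>n. b m + b n + d (e (s n)) x) \<longlonglongrightarrow> b m"
        using tendsto_add[OF tendsto_add[OF tendsto_const b] lim] by simp
      have "d (e (s m)) x \<le> b m + b n + d (e (s n)) x" for n
      proof -
        have "d (e (s m)) (e (s n)) \<le> b m + b n" using that by (simp add: C_def)
        then show ?thesis
          using triangle[OF e[of "s m"] e[of "s n"] \<open>x \<in> M\<close>] by linarith
      qed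
      then show "\<exists>N. \<forall>n\<ge>N. d (e (s m)) x \<le> b m + b n + d (e (s n)) x" by blast
    qed
    then show ?thesis using \<open>x \<in> M\<close> by blast
  qed
  then obtain f where f: "\<And>s. s \<in> C \<Longrightarrow> f s \<in> M" "\<And>s m. s \<in> C \<Longrightarrow> d (e (s m)) (f s) \<le> b m"
    by metis
  have "continuous_map (top_of_set C) mtopology f"
    unfolding continuous_map_to_metric
  proof (intro ballI allI impI)
    fix s :: "nat \<Rightarrow> nat" and \<epsilon> :: real
    assume s: "s \<in> topspace (top_of_set C)" and "\<epsilon> > 0"
    then have "eventually (\<lambda>n. b n < \<epsilon> / 2) sequentially"
      using b by (intro order_tendstoD(2)) auto
    then obtain n where n: "b n < \<epsilon> / 2"
      by (auto simp: eventually_sequentially)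
    \<comment> \<open>Agreement in the single coordinate \<open>n\<close> already puts both limits
      within \<open>b n\<close> of the same point, hence within \<epsilon> of each other.\<close>
    have "open ((\<lambda>t. t n) -` {s n})"
      by (intro open_vimage open_discrete continuous_on_product_coordinates)
    then have "openin (top_of_set C) (C \<inter> (\<lambda>t. t n) -` {s n})"
      by blast
    moreover have "f t \<in> mball (f s) \<epsilon>" if t: "t \<in> C" "t n = s n" for t
    proof -
      have "d (f s) (f t) \<le> d (f s) (e (s n)) + d (e (s n)) (f t)"
        using s t f e by (intro triangle) auto
      also have "\<dots> \<le> b n + b n"
        using f(2)[of s n] f(2)[of t n] s t by (auto simp: commute)
      finally show ?thesis using n f s t by auto
    qed
    ultimately show "\<exists>U. openin (top_of_set C) U \<and> s \<in> U \<and> (\<forall>t\<in>U. f t \<in> mball (f s) \<epsilon>)"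
      using s by (intro exI[of _ "C \<inter> (\<lambda>t. t n) -` {s n}"]) auto
  qed
  moreover have "M \<subseteq> f ` C"
  proof
    fix x assume "x \<in> M"
    have "\<exists>i. d (e i) x < b m" for m
    proof -
      have "x \<in> mtopology closure_of S" using S(3) M(3) \<open>x \<in> M\<close> by simp
      then obtain y where "y \<in> S" "y \<in> mball x (b m)"
        using b_pos[of m] unfolding metric_closure_of by blast
      then show ?thesis
        using from_nat_into_surj[OF S(1), of y] by (auto simp: e_def commute)
    qed
    then obtain s where s: "\<And>m. d (e (s m)) x < b m" by metis
    have "s \<in> C"
      unfolding C_def
    proof (clarify)
      fix m n
      show "d (e (s m)) (e (s n)) \<le> b m + b n"
        using triangle[OF e[of "s m"] \<open>x \<in> M\<close> e[of "s n"]] s[of m] s[of n] by (simp add: commute)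
    qed
    have "(\<lambda>n. b n + b n) \<longlonglongrightarrow> 0" using tendsto_add[OF b b] by simp
    moreover have "d x (f s) \<le> b n + b n" for n
      using triangle[OF \<open>x \<in> M\<close> e[of "s n"] f(1)[OF \<open>s \<in> C\<close>]] f(2)[OF \<open>s \<in> C\<close>, of n] s[of n]
      by (simp add: commute)
    ultimately have "d x (f s) \<le> 0"
      using LIMSEQ_le_const[of "\<lambda>n. b n + b n" 0 "d x (f s)"] by blast
    then have "x = f s" using \<open>x \<in> M\<close> f(1)[OF \<open>s \<in> C\<close>] nonneg zero by (metis antisym)
    then show "x \<in> f ` C" using \<open>s \<in> C\<close> by blast
  qed
  ultimately show ?thesis
    unfolding analytic_in_def using \<open>closed C\<close> f(1) M(3)
    by (intro exI[of _ C] exI[of _ f]) auto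
qed

text \<open>Analytic sets need not have analytic complements, so the induction over the generated
  sigma-algebra carries the complement along. Open sets enter as countable unions of closed
  sets.\<close>

lemma analytic_in_borel:
  assumes X: "polish_space X" and "A \<in> sets (borel_of X)"
  shows "analytic_in X A"
proof -
  note H = polish_space_imp_Hausdorff_space[OF X]
  have closedin: "analytic_in X F" if "closedin X F" for F
    using analytic_in_Int_closedin[OF analytic_in_topspace[OF X] that] closedin_subset[OF that]
    by (simp add: Int_absorb1)
  have fsigma: "analytic_in X F" if "fsigma_in X F" for F
  proof -
    have "\<exists>C :: nat \<Rightarrow> _. (\<forall>n. closedin X (C n)) \<and> \<Union>(range C) = F"
      using that unfolding fsigma_in_ascending by auto
    then obtain C :: "nat \<Rightarrow> _" where C: "\<And>n. closedin X (C n)" "\<Union>(range C) = F"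
      by auto
    show ?thesis using analytic_in_UN[where A = C, OF closedin[OF C(1)]] C(2) by simp
  qed
  have "A \<in> sigma_sets (topspace X) {U. openin X U}"
    using assms(2) by (simp add: sets_borel_of)
  then have "analytic_in X A \<and> analytic_in X (topspace X - A)"
  proof induction
    case (Basic U)
    then show ?case
      using X by (auto intro: fsigma closedin open_imp_fsigma_in completely_metrizable_imp_metrizable_space
          simp: polish_space_def)
  next
    case Empty
    then show ?case by (auto intro!: closedin)
  next
    case (Compl A)
    then have "A \<subseteq> topspace X"
      using sigma_sets_into_sp[of "{U. openin X U}" "topspace X" A] by (auto dest: openin_subset)
    then show ?case using Compl by (simp add: double_diff)
  next
    case (Union A)
    have "topspace X - (\<Union>n. A n) = (\<Inter>n. topspace X - A n)" by auto
    then have "analytic_in X (topspace X - (\<Union>n. A n))"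
      using analytic_in_INT[OF H, of "\<lambda>n. topspace X - A n"] Union(2) by metis
    then show ?case using analytic_in_UN Union(2) by blast
  qed
  then show ?thesis ..
qed

section \<open>Separation of analytic sets by Borel sets\<close>

definition borel_separable :: "'a topology \<Rightarrow> 'a set \<Rightarrow> 'a set \<Rightarrow> bool"
  where "borel_separable X A B \<longleftrightarrow> (\<exists>S\<in>sets (borel_of X). A \<subseteq> S \<and> S \<inter> B = {})"

text \<open>Intersecting the separators over \<open>n\<close> separates one \<open>A m\<close> from
  every \<open>B n\<close>; the union over \<open>m\<close> then treats all \<open>A m\<close>
  together.\<close>

lemma borel_separable_UN_UN:
  fixes A B :: "nat \<Rightarrow> 'a set"
  assumes "\<And>m n. borel_separable X (A m) (B n)"
  shows "borel_separable X (\<Union>m. A m) (\<Union>n. B n)"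
proof -
  have "\<forall>m n. \<exists>S. S \<in> sets (borel_of X) \<and> A m \<subseteq> S \<and> S \<inter> B n = {}"
    using assms unfolding borel_separable_def Bex_def by simp
  then obtain S where
    "\<forall>m n. S m n \<in> sets (borel_of X) \<and> A m \<subseteq> S m n \<and> S m n \<inter> B n = {}"
    unfolding choice_iff by auto
  then have S: "S m n \<in> sets (borel_of X)" "A m \<subseteq> S m n" "S m n \<inter> B n = {}" for m n
    by auto
  have "(\<Union>m. \<Inter>n. S m n) \<in> sets (borel_of X)"
    using S(1) by (intro sets.countable_UN sets.countable_INT) auto
  moreover have "(\<Union>m. A m) \<subseteq> (\<Union>m. \<Inter>n. S m n)"
    using S(2) by auto
  moreover have "(\<Union>m. \<Inter>n. S m n) \<inter> (\<Union>n. B n) = {}"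
  proof (intro equals0I)
    fix x assume "x \<in> (\<Union>m. \<Inter>n. S m n) \<inter> (\<Union>n. B n)"
    then obtain m n where "x \<in> S m n" "x \<in> B n" by auto
    with S(3)[of m n] show False by auto
  qed
  ultimately show ?thesis unfolding borel_separable_def by blast
qed

text \<open>If two analytic sets could not be separated, one could shrink their parametrising sets to
  cylinders around two points \<open>s\<close>, \<open>t\<close> and never reach separable images; but
  the images of \<open>s\<close> and \<open>t\<close> are separated by open sets.\<close>

theorem Lusin_separation:
  assumes X: "Hausdorff_space X" and A: "analytic_in X A" and B: "analytic_in X B"
    and disj: "A \<inter> B = {}"
  shows "borel_separable X A B"
proof (rule ccontr)
  obtain C D and f g :: "(nat \<Rightarrow> nat) \<Rightarrow> _" where
    C: "closed C" "continuous_map (top_of_set C) X f" "A = f ` C" and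
    D: "closed D" "continuous_map (top_of_set D) X g" "B = g ` D"
    using A B unfolding analytic_in_def by blast
  define cyl :: "(nat \<Rightarrow> nat) \<Rightarrow> nat \<Rightarrow> (nat \<Rightarrow> nat) set" where "cyl s n = {t. \<forall>i<n. t i = s i}" for s n
  have cyl_cong: "cyl s n = cyl t n" if "\<And>i. i < n \<Longrightarrow> s i = t i" for s t n
    using that by (auto simp: cyl_def)
  have cyl_Suc: "cyl s n = (\<Union>m. cyl (s(n := m)) (Suc n))" for s n
  proof (intro equalityI subsetI)
    fix t assume "t \<in> cyl s n"
    then have "t \<in> cyl (s(n := t n)) (Suc n)" by (auto simp: cyl_def less_Suc_eq)
    then show "t \<in> (\<Union>m. cyl (s(n := m)) (Suc n))" by blast
  next
    fix t assume "t \<in> (\<Union>m. cyl (s(n := m)) (Suc n))"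
    then obtain m where m: "t i = (s(n := m)) i" if "i < Suc n" for i
      by (auto simp: cyl_def)
    have "t i = s i" if "i < n" for i
      using m[of i] that by simp
    then show "t \<in> cyl s n" by (simp add: cyl_def)
  qed
  have open_cyl: "\<exists>n. cyl s n \<subseteq> U" if "open U" "s \<in> U" for s U
  proof -
    have "\<exists>Y. s \<in> Pi\<^sub>E UNIV Y \<and> (\<forall>i. openin euclidean (Y i)) \<and>
        finite {i. Y i \<noteq> topspace euclidean} \<and> Pi\<^sub>E UNIV Y \<subseteq> U"
      using that by (intro product_topology_open_contains_basis) (auto simp: open_fun_def)
    then obtain Y where Y: "s \<in> Pi\<^sub>E UNIV Y" "finite {i. Y i \<noteq> UNIV}" "Pi\<^sub>E UNIV Y \<subseteq> U"
      by (elim exE conjE) simp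
    then obtain n where n: "\<And>i. Y i \<noteq> UNIV \<Longrightarrow> i < n"
      using finite_nat_set_iff_bounded by auto
    have "cyl s n \<subseteq> Pi\<^sub>E UNIV Y"
    proof
      fix t assume t: "t \<in> cyl s n"
      have "t i \<in> Y i" for i
        using n[of i] t Y(1) by (cases "Y i = UNIV") (auto simp: cyl_def PiE_iff)
      then show "t \<in> Pi\<^sub>E UNIV Y" by auto
    qed
    with Y(3) show ?thesis by blast
  qed
  have mem_closed: "s \<in> E" if E: "closed E" "\<And>n. E \<inter> cyl s n \<noteq> {}" for s E
    using open_cyl[of "- E" s] E by blast
  define bad where "bad s t n \<longleftrightarrow> \<not> borel_separable X (f ` (C \<inter> cyl s n)) (g ` (D \<inter> cyl t n))" for s t n
  have bad_cong: "bad s t n = bad s' t' n" if "\<And>i. i < n \<Longrightarrow> s i = s' i" "\<And>i. i < n \<Longrightarrow> t i = t' i"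
    for s t s' t' n
    unfolding bad_def using cyl_cong[of n s s'] cyl_cong[of n t t'] that by simp
  have bad_step: "\<exists>p q. bad (s(n := p)) (t(n := q)) (Suc n)" if "bad s t n" for s t n
  proof (rule ccontr)
    assume "\<not> ?thesis"
    then have "borel_separable X (\<Union>p. f ` (C \<inter> cyl (s(n := p)) (Suc n))) (\<Union>q. g ` (D \<inter> cyl (t(n := q)) (Suc n)))"
      unfolding bad_def by (intro borel_separable_UN_UN) blast
    moreover have "(\<Union>p. f ` (C \<inter> cyl (s(n := p)) (Suc n))) = f ` (C \<inter> cyl s n)"
      "(\<Union>q. g ` (D \<inter> cyl (t(n := q)) (Suc n))) = g ` (D \<inter> cyl t n)"
      unfolding cyl_Suc[of s n] cyl_Suc[of t n] by (simp_all only: Int_UN_distrib image_UN)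
    ultimately show False using that unfolding bad_def by simp
  qed
  assume "\<not> borel_separable X A B"
  \<comment> \<open>Cylinders of length 0 are the whole space, so the zero sequences are mere
    placeholders.\<close>
  then have bad0: "bad (\<lambda>_. 0) (\<lambda>_. 0) 0"
    by (simp add: bad_def cyl_def C D)
  define P where "P n st \<longleftrightarrow> bad (fst st) (snd st) n" for n and st :: "(nat \<Rightarrow> nat) \<times> (nat \<Rightarrow> nat)"
  \<comment> \<open>Stage \<open>n\<close> may change only coordinate \<open>n\<close>. Thus
    coordinate \<open>i\<close> is settled from stage \<open>Suc i\<close> on, and the limits
    \<open>s\<close> and \<open>t\<close> below agree with stage \<open>n\<close> on the first
    \<open>n\<close> coordinates.\<close>
  define Q where "Q n st st' \<longleftrightarrow> (\<forall>i. i \<noteq> n \<longrightarrow> fst st' i = fst st i \<and> snd st' i = snd st i)"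
    for n and st st' :: "(nat \<Rightarrow> nat) \<times> (nat \<Rightarrow> nat)"
  have "\<exists>st. \<forall>n. P n (st n) \<and> Q n (st n) (st (Suc n))"
  proof (rule dependent_nat_choice)
    show "\<exists>x. P 0 x" using bad0 by (auto simp: P_def)
    show "\<exists>y. P (Suc n) y \<and> Q n x y" if "P n x" for x n
    proof -
      obtain p q where "bad ((fst x)(n := p)) ((snd x)(n := q)) (Suc n)"
        using bad_step \<open>P n x\<close> unfolding P_def by blast
      then show ?thesis
        by (intro exI[of _ "((fst x)(n := p), (snd x)(n := q))"]) (auto simp: P_def Q_def)
    qed
  qed
  then obtain st where st: "\<And>n. P n (st n)" "\<And>n. Q n (st n) (st (Suc n))"
    by blast
  define s where "s i = fst (st (Suc i)) i" for i
  define t where "t i = snd (st (Suc i)) i" for i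
  have agree: "fst (st n) i = s i \<and> snd (st n) i = t i" if "i < n" for n i
    using that
  proof (induction n)
    case (Suc n)
    show ?case
    proof (cases "i = n")
      case False
      then show ?thesis using Suc st(2)[of n] by (auto simp: Q_def)
    qed (simp add: s_def t_def)
  qed simp
  have bad: "bad s t n" for n
    using st(1)[of n] bad_cong[of n "fst (st n)" s "snd (st n)" t] agree by (simp add: P_def)
  \<comment> \<open>Separation is trivial when one side is empty, so badness makes every cylinder
    meet its parameter set; closedness then puts \<open>s\<close> in \<open>C\<close> and
    \<open>t\<close> in \<open>D\<close>.\<close>
  have nonempty: "C \<inter> cyl s n \<noteq> {}" "D \<inter> cyl t n \<noteq> {}" for n
  proof -
    have "borel_separable X {} (g ` (D \<inter> cyl t n))"
      unfolding borel_separable_def by (rule bexI[of _ "{}"]) auto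
    with bad[of n] show "C \<inter> cyl s n \<noteq> {}" unfolding bad_def by auto
    have "f ` (C \<inter> cyl s n) \<subseteq> topspace X"
      using continuous_map_image_subset_topspace[OF C(2)] by auto
    then have "borel_separable X (f ` (C \<inter> cyl s n)) {}"
      unfolding borel_separable_def
      by (intro bexI[of _ "topspace X"] openin_imp_sets_borel_of openin_topspace) auto
    with bad[of n] show "D \<inter> cyl t n \<noteq> {}" unfolding bad_def by auto
  qed
  have "s \<in> C" "t \<in> D"
    using mem_closed[OF C(1) nonempty(1)] mem_closed[OF D(1) nonempty(2)] by auto
  then have "f s \<in> A" "g t \<in> B" using C(3) D(3) by auto
  then have "f s \<noteq> g t" using disj by auto
  moreover have "f s \<in> topspace X" "g t \<in> topspace X"
    using continuous_map_image_subset_topspace[OF C(2)] continuous_map_image_subset_topspace[OF D(2)]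
      \<open>s \<in> C\<close> \<open>t \<in> D\<close> by auto
  ultimately obtain U V where UV: "openin X U" "openin X V" "f s \<in> U" "g t \<in> V" "disjnt U V"
    using X unfolding Hausdorff_space_def by blast
  obtain U' where U': "open U'" "{x \<in> C. f x \<in> U} = C \<inter> U'"
    using openin_continuous_map_preimage[OF C(2) UV(1)] by (auto simp: openin_open)
  obtain V' where V': "open V'" "{x \<in> D. g x \<in> V} = D \<inter> V'"
    using openin_continuous_map_preimage[OF D(2) UV(2)] by (auto simp: openin_open)
  have "s \<in> U'" "t \<in> V'"
    using U' V' UV \<open>s \<in> C\<close> \<open>t \<in> D\<close> by blast+
  then obtain k l where kl: "cyl s k \<subseteq> U'" "cyl t l \<subseteq> V'"
    using open_cyl[OF U'(1)] open_cyl[OF V'(1)] by blast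
  have "cyl s (max k l) \<subseteq> cyl s k" "cyl t (max k l) \<subseteq> cyl t l"
    by (auto simp: cyl_def)
  then have "f ` (C \<inter> cyl s (max k l)) \<subseteq> U" "g ` (D \<inter> cyl t (max k l)) \<subseteq> V"
    using kl U'(2) V'(2) by blast+
  then have "borel_separable X (f ` (C \<inter> cyl s (max k l))) (g ` (D \<inter> cyl t (max k l)))"
    unfolding borel_separable_def using UV
    by (intro bexI[of _ U] openin_imp_sets_borel_of) (auto simp: disjnt_def)
  with bad[of "max k l"] show False by (simp add: bad_def)
qed

text \<open>The two images are analytic and complementary, so a Borel set containing the first and
  missing the second equals the first.\<close>

corollary continuous_image_in_sets_borel_of:
  assumes Y: "polish_space Y" and X: "Hausdorff_space X" and p: "continuous_map Y X p"
    and AB: "A \<in> sets (borel_of Y)" "B \<in> sets (borel_of Y)"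
    and "p ` A \<inter> p ` B = {}" "p ` A \<union> p ` B = topspace X"
  shows "p ` A \<in> sets (borel_of X)"
proof -
  note img = analytic_in_continuous_map_image[OF analytic_in_borel[OF Y] p]
  have "borel_separable X (p ` A) (p ` B)"
    using Lusin_separation[OF X img[OF AB(1)] img[OF AB(2)] assms(6)] .
  then obtain S where S: "S \<in> sets (borel_of X)" "p ` A \<subseteq> S" "S \<inter> p ` B = {}"
    unfolding borel_separable_def by (elim bexE conjE)
  have "S \<subseteq> p ` A \<union> p ` B"
    using sets.sets_into_space[OF S(1)] assms(7) by simp
  then have "S \<subseteq> p ` A" using S(3) by auto
  then have "S = p ` A" using S(2) by (rule equalityI)
  with S(1) show ?thesis by simp
qed

section \<open>Polish spaces\<close>

lemma polish_space_prod_topology: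
  assumes "polish_space X" "polish_space Y"
  shows "polish_space (prod_topology X Y)"
proof -
  obtain C D where "countable C" "C \<subseteq> topspace X" "X closure_of C = topspace X"
    "countable D" "D \<subseteq> topspace Y" "Y closure_of D = topspace Y"
    using assms unfolding polish_space_def separable_space_def by auto
  then have "separable_space (prod_topology X Y)"
    unfolding separable_space_def
    by (intro exI[of _ "C \<times> D"]) (auto simp: closure_of_Times)
  then show ?thesis
    using assms by (simp add: polish_space_def completely_metrizable_space_prod_topology)
qed

lemma polish_space_product_topology:
  assumes "finite I" "\<And>i. i \<in> I \<Longrightarrow> polish_space (X i)"
  shows "polish_space (product_topology X I)"
proof -
  obtain C where C: "\<And>i. i \<in> I \<Longrightarrow> countable (C i)" "\<And>i. i \<in> I \<Longrightarrow> C i \<subseteq> topspace (X i)"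
    "\<And>i. i \<in> I \<Longrightarrow> (X i) closure_of (C i) = topspace (X i)"
    using assms(2) unfolding polish_space_def separable_space_def by metis
  have "separable_space (product_topology X I)"
    unfolding separable_space_def
  proof (intro exI[of _ "Pi\<^sub>E I C"] conjI)
    show "countable (Pi\<^sub>E I C)" using assms(1) C(1) by (rule countable_PiE)
    show "Pi\<^sub>E I C \<subseteq> topspace (product_topology X I)" using C(2) by (auto simp: PiE_iff)
    show "product_topology X I closure_of Pi\<^sub>E I C = topspace (product_topology X I)"
      using C(3) by (auto simp: closure_of_product_topology intro!: PiE_cong)
  qed
  moreover have "completely_metrizable_space (product_topology X I)"
    using assms unfolding completely_metrizable_space_product_topology polish_space_def
    by (auto intro: countable_finite)
  ultimately show ?thesis by (simp add: polish_space_def)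
qed

text \<open>Urysohn's metrization theorem: Urysohn functions for the pairs of basic sets embed the space
  into a countable power of the real line.\<close>

theorem second_countable_imp_metrizable_space:
  fixes X :: "'a topology"
  assumes reg: "regular_space X" and H: "Hausdorff_space X" and sc: "second_countable X"
  shows "metrizable_space X"
proof -
  obtain \<B> where \<B>: "countable \<B>" "\<And>V. V \<in> \<B> \<Longrightarrow> openin X V"
    "\<And>U x. openin X U \<Longrightarrow> x \<in> U \<Longrightarrow> \<exists>V\<in>\<B>. x \<in> V \<and> V \<subseteq> U"
    using sc unfolding second_countable_def by metis
  have normal: "normal_space X"
    using regular_second_countable_imp_hereditarily_normal_space[of X] reg sc
    by (metis hereditarily_def subtopology_topspace order_refl)
  \<comment> \<open>Regularity supplies enough such pairs to separate points from closed sets, while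
    countability of the base keeps the target power metrizable.\<close>
  define J where "J = {(V, W) \<in> \<B> \<times> \<B>. X closure_of V \<subseteq> W}"
  have "countable J"
    by (rule countable_subset[of _ "\<B> \<times> \<B>"]) (auto simp: J_def \<B>(1))
  have "\<forall>j\<in>J. \<exists>f :: 'a \<Rightarrow> real. continuous_map X euclideanreal f \<and>
      f ` (X closure_of (fst j)) \<subseteq> {0} \<and> f ` (topspace X - snd j) \<subseteq> {1}"
  proof
    fix j assume "j \<in> J"
    then have "closedin X (topspace X - snd j)" "disjnt (X closure_of (fst j)) (topspace X - snd j)"
      using \<B>(2) by (auto simp: J_def disjnt_def)
    then show "\<exists>f :: 'a \<Rightarrow> real. continuous_map X euclideanreal f \<and>
        f ` (X closure_of (fst j)) \<subseteq> {0} \<and> f ` (topspace X - snd j) \<subseteq> {1}"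
      using Urysohn_lemma_alt[OF normal closedin_closure_of, of "topspace X - snd j" "fst j" 0 1] by metis
  qed
  from bchoice[OF this] obtain f :: "'a set \<times> 'a set \<Rightarrow> 'a \<Rightarrow> real" where
    "\<forall>j\<in>J. continuous_map X euclideanreal (f j) \<and>
      f j ` (X closure_of (fst j)) \<subseteq> {0} \<and> f j ` (topspace X - snd j) \<subseteq> {1}" ..
  then have f: "continuous_map X euclideanreal (f j)"
    "f j ` (X closure_of (fst j)) \<subseteq> {0}" "f j ` (topspace X - snd j) \<subseteq> {1}" if "j \<in> J" for j
    using that by auto
  define F where "F x = (\<lambda>j\<in>J. f j x)" for x
  define Y where "Y = product_topology (\<lambda>_. euclideanreal) J"
  have contF: "continuous_map X Y F"
    unfolding Y_def F_def using f(1) by (auto intro!: continuous_map_coordinatewise_then_product)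
  \<comment> \<open>Regularity puts a closed \<open>E\<close> between \<open>x\<close> and a basic
    \<open>W\<close> inside \<open>U\<close>, and a basic \<open>V\<close> inside \<open>E\<close>
    completes a pair in \<open>J\<close>. The claim serves both openness of \<open>F\<close> onto
    its image and injectivity.\<close>
  have key: "\<exists>j\<in>J. f j x = 0 \<and> {y \<in> topspace X. f j y \<noteq> 1} \<subseteq> U" if U: "openin X U" "x \<in> U" for U x
  proof -
    obtain W where W: "W \<in> \<B>" "x \<in> W" "W \<subseteq> U" using \<B>(3)[OF U] by blast
    obtain N E where N: "openin X N" "closedin X E" "x \<in> N" "N \<subseteq> E" "E \<subseteq> W"
      using reg \<B>(2)[OF W(1)] W(2) unfolding neighbourhood_base_of_closedin[symmetric] neighbourhood_base_of
      by metis
    obtain V where V: "V \<in> \<B>" "x \<in> V" "V \<subseteq> N" using \<B>(3)[OF N(1,3)] by blast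
    have "X closure_of V \<subseteq> W"
      using closure_of_minimal[of V E X] V N by blast
    then have j: "(V, W) \<in> J" using V W by (simp add: J_def)
    have "x \<in> X closure_of V"
      using V(2) closure_of_subset[OF openin_subset[OF \<B>(2)[OF V(1)]]] by auto
    then have "f (V, W) x = 0" using f(2)[OF j] by auto
    moreover have "{y \<in> topspace X. f (V, W) y \<noteq> 1} \<subseteq> U" using f(3)[OF j] W(3) by auto
    ultimately show ?thesis using j by blast
  qed
  have "embedding_map X Y F"
    unfolding embedding_map_def homeomorphic_map_def
  proof
    have "open_map X (subtopology Y (F ` topspace X)) F"
      unfolding open_map_def
    proof (intro allI impI)
      fix U assume U: "openin X U"
      show "openin (subtopology Y (F ` topspace X)) (F ` U)"
        unfolding openin_subopen[of _ "F ` U"]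
      proof
        fix z assume "z \<in> F ` U"
        then obtain x where x: "x \<in> U" "z = F x" by blast
        then obtain j where j: "j \<in> J" "f j x = 0" "{y \<in> topspace X. f j y \<noteq> 1} \<subseteq> U"
          using key[OF U] by blast
        have "openin Y {z \<in> topspace Y. z j \<in> - {1}}"
          unfolding Y_def using j(1)
          by (intro openin_continuous_map_preimage[where Y = euclideanreal] continuous_map_product_projection) auto
        then have "openin (subtopology Y (F ` topspace X)) ({z \<in> topspace Y. z j \<in> - {1}} \<inter> F ` topspace X)"
          by (rule openin_subtopology_Int)
        moreover have "x \<in> topspace X" using openin_subset[OF U] x by blast
        then have "z \<in> {z \<in> topspace Y. z j \<in> - {1}} \<inter> F ` topspace X"
          using x j by (auto simp: Y_def F_def)
        moreover have "{z \<in> topspace Y. z j \<in> - {1}} \<inter> F ` topspace X \<subseteq> F ` U"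
          using j by (auto simp: F_def)
        ultimately show "\<exists>T. openin (subtopology Y (F ` topspace X)) T \<and> z \<in> T \<and> T \<subseteq> F ` U"
          by blast
      qed
    qed
    then show "quotient_map X (subtopology Y (F ` topspace X)) F"
      using contF continuous_map_image_subset_topspace[OF contF]
      by (simp add: continuous_open_quotient_map continuous_map_in_subtopology Int_absorb1)
    show "inj_on F (topspace X)"
    proof (rule inj_onI, rule ccontr)
      fix x y assume xy: "x \<in> topspace X" "y \<in> topspace X" "F x = F y" "x \<noteq> y"
      obtain U where U: "openin X U" "x \<in> U" "y \<notin> U"
        using H xy unfolding Hausdorff_space_def disjnt_def by blast
      obtain j where "j \<in> J" "f j x = 0" "{y \<in> topspace X. f j y \<noteq> 1} \<subseteq> U"
        using key[OF U(1,2)] by blast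
      moreover from this have "f j x = f j y" using xy(3) by (metis F_def restrict_apply')
      ultimately show False using xy(2) U(3) by auto
    qed
  qed
  then have "X homeomorphic_space subtopology Y (F ` topspace X)"
    unfolding embedding_map_def by (rule homeomorphic_map_imp_homeomorphic_space)
  moreover have "metrizable_space Y"
    unfolding Y_def using \<open>countable J\<close>
    by (intro completely_metrizable_imp_metrizable_space)
      (auto simp: completely_metrizable_space_product_topology completely_metrizable_space_euclidean
        intro: countable_subset)
  ultimately show ?thesis
    using homeomorphic_metrizable_space metrizable_space_subtopology by blast
qed

text \<open>Local compactness and the Hausdorff property give regularity, hence metrizability; a
  locally compact metrizable space is completely metrizable.\<close>

lemma (in lcsc_group) polish_space: "polish_space T"
proof -
  have "regular_space T"
    using locally_compact_Hausdorff_imp_regular_space locally_compact hausdorff by blast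
  then have "metrizable_space T"
    using hausdorff second_countable by (rule second_countable_imp_metrizable_space)
  then show ?thesis
    unfolding polish_space_def
    using locally_compact second_countable locally_compact_imp_completely_metrizable_space
      second_countable_imp_separable_space by blast
qed

section \<open>Return times in topological groups\<close>

context topological_group
begin

lemma continuous_map_group_mult:
  assumes "continuous_map Y T f" "continuous_map Y T g"
  shows "continuous_map Y T (\<lambda>y. f y \<otimes> g y)"
proof -
  have "continuous_map Y (prod_topology T T) (\<lambda>y. (f y, g y))"
    using assms by (simp add: continuous_map_paired)
  from continuous_map_compose[OF this continuous_mult] show ?thesis
    by (simp add: o_def)
qed

lemma continuous_map_group_inv:
  assumes "continuous_map Y T f"
  shows "continuous_map Y T (\<lambda>y. inv (f y))"
  using continuous_map_compose[OF assms continuous_inv] by (simp add: o_def)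

text \<open>This is the tube lemma for the conjugation map, which sends all of
  \<open>{\<one>}\<close> times \<open>K\<close> to \<open>\<one>\<close>.\<close>

lemma open_conjugation_compact:
  assumes K: "compactin T K" and U: "openin T U" "\<one> \<in> U"
  obtains W where "openin T W" "\<one> \<in> W" "\<And>k w. k \<in> K \<Longrightarrow> w \<in> W \<Longrightarrow> inv k \<otimes> w \<otimes> k \<in> U"
proof -
  define c where "c p = inv (snd p) \<otimes> fst p \<otimes> snd p" for p
  have c: "continuous_map (prod_topology T T) T c"
    unfolding c_def
    by (intro continuous_map_group_mult continuous_map_group_inv continuous_map_fst continuous_map_snd)
  have sub: "{\<one>} \<times> K \<subseteq> {p \<in> topspace (prod_topology T T). c p \<in> U}"
    using compactin_subset_topspace[OF K] U(2) by (auto simp: c_def topspace_carrier subset_iff)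
  have one: "compactin T {\<one>}"
    by (simp add: compactin_sing topspace_carrier)
  obtain W V where WV: "openin T W" "openin T V" "{\<one>} \<subseteq> W" "K \<subseteq> V"
    "W \<times> V \<subseteq> {p \<in> topspace (prod_topology T T). c p \<in> U}"
    by (rule Wallace_theorem_prod_topology[OF one K openin_continuous_map_preimage[OF c U(1)] sub])
  have "inv k \<otimes> w \<otimes> k \<in> U" if "k \<in> K" "w \<in> W" for k w
  proof -
    have "(w, k) \<in> W \<times> V" using that WV(4) by auto
    then have "c (w, k) \<in> U" using WV(5) by auto
    then show ?thesis by (simp add: c_def)
  qed
  with WV(1,3) show ?thesis by (intro that) auto
qed

end

lemma accumulates_at_one_mono:
  "accumulates_at_one G T A \<Longrightarrow> A \<subseteq> B \<Longrightarrow> accumulates_at_one G T B"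
  unfolding accumulates_at_one_def by blast

text \<open>Each \<open>a \<in> A\<close> is isolated in \<open>A\<close> because \<open>inv a \<in> A\<close> translates it to the identity.\<close>

lemma (in lcsc_group) not_accumulates_imp_countable:
  assumes A: "A \<subseteq> carrier G" "\<And>a. a \<in> A \<Longrightarrow> inv a \<in> A"
    and acc: "\<not> accumulates_at_one G T (A <#> A)"
  shows "countable A"
proof -
  obtain U where U: "openin T U" "\<one> \<in> U" "(A <#> A) \<inter> U \<subseteq> {\<one>}"
    using acc unfolding accumulates_at_one_def by auto
  obtain \<B> where \<B>: "countable \<B>" "\<And>V x. openin T V \<Longrightarrow> x \<in> V \<Longrightarrow> \<exists>B\<in>\<B>. x \<in> B \<and> B \<subseteq> V"
    using second_countable unfolding second_countable_def by auto
  have "\<exists>B. B \<in> \<B> \<and> a \<in> B \<and> B \<inter> A \<subseteq> {a}" if a: "a \<in> A" for a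
  proof -
    have aG: "a \<in> carrier G" using a A(1) by auto
    have "continuous_map T T (\<lambda>x. inv a \<otimes> x)"
      using aG by (intro continuous_map_group_mult continuous_map_id[unfolded id_def]) (simp add: topspace_carrier)
    from openin_continuous_map_preimage[OF this U(1)]
    have "openin T {x \<in> topspace T. inv a \<otimes> x \<in> U}" .
    moreover have "a \<in> {x \<in> topspace T. inv a \<otimes> x \<in> U}"
      using aG U(2) by (simp add: topspace_carrier)
    ultimately obtain B where B: "B \<in> \<B>" "a \<in> B" "B \<subseteq> {x \<in> topspace T. inv a \<otimes> x \<in> U}"
      using \<B>(2) by meson
    have "x = a" if "x \<in> B" "x \<in> A" for x
    proof -
      have "inv a \<otimes> x \<in> A <#> A" using a A(2) that by (auto simp: set_mult_def)
      then have "inv a \<otimes> x = \<one>" using U(3) B(3) that by auto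
      then show "x = a" using aG that A(1) by (metis inv_closed inv_equality inv_inv subsetD)
    qed
    then show ?thesis using B by auto
  qed
  then obtain B where B: "\<And>a. a \<in> A \<Longrightarrow> B a \<in> \<B>" "\<And>a. a \<in> A \<Longrightarrow> a \<in> B a" "\<And>a. a \<in> A \<Longrightarrow> B a \<inter> A \<subseteq> {a}"
    by metis
  \<comment> \<open>Basic sets isolating different points differ, so \<open>A\<close> injects into
    the countable base.\<close>
  have "inj_on B A"
    using B(2,3) by (intro inj_onI) blast
  moreover have "countable (B ` A)"
    using B(1) by (intro countable_subset[OF _ \<B>(1)]) auto
  ultimately show ?thesis by (rule countable_image_inj_on[rotated])
qed

section \<open>Return times of a group action\<close>

text \<open>\<open>h \<otimes> inv g\<close> carries the visit \<open>\<phi> g x\<close> to the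
  visit \<open>\<phi> h x\<close>: two visits of one orbit to \<open>Z\<close> produce a return
  time.\<close>

lemma (in group_action) return_times_transition:
  assumes "x \<in> E" "g \<in> carrier G" "h \<in> carrier G" "\<phi> g x \<in> Z" "\<phi> h x \<in> Z"
  shows "h \<otimes> inv g \<in> return_times G \<phi> Z"
proof -
  interpret group G using group_hom unfolding group_hom_def by simp
  have "\<phi> (h \<otimes> inv g) (\<phi> g x) = \<phi> ((h \<otimes> inv g) \<otimes> g) x"
    using assms by (intro composition_rule[symmetric]) auto
  also have "(h \<otimes> inv g) \<otimes> g = h"
    using assms by (simp add: m_assoc)
  finally have "\<phi> (h \<otimes> inv g) (\<phi> g x) \<in> Z" using assms by simp
  then show ?thesis using assms by (auto simp: return_times_def)
qed

lemma (in group_action) return_times_inv: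
  assumes "Z \<subseteq> E" "h \<in> return_times G \<phi> Z"
  shows "inv h \<in> return_times G \<phi> Z"
proof -
  interpret group G using group_hom unfolding group_hom_def by simp
  obtain z where z: "z \<in> Z" "\<phi> h z \<in> Z" "h \<in> carrier G"
    using assms(2) by (auto simp: return_times_def)
  then have "\<phi> \<one> z = z" using assms(1) id_eq_one by (metis restrict_apply' subsetD)
  then have "\<one> \<otimes> inv h \<in> return_times G \<phi> Z"
    using z assms(1) by (intro return_times_transition) auto
  then show ?thesis using z by simp
qed

text \<open>Any point of \<open>Z\<close> is returned to itself by \<open>\<one>\<close>. This later
  allows shorter products of return times to be padded to threefold ones.\<close>

lemma (in group_action) one_in_return_times:
  assumes "Z \<subseteq> E" "Z \<noteq> {}"
  shows "\<one> \<in> return_times G \<phi> Z"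
proof -
  interpret group G using group_hom unfolding group_hom_def by simp
  obtain z where "z \<in> Z" using assms by auto
  then have "\<phi> \<one> z = z" using assms(1) id_eq_one by (metis restrict_apply' subsetD)
  then show ?thesis using \<open>z \<in> Z\<close> by (auto simp: return_times_def)
qed

text \<open>Both the set and its complement are projections of Borel subsets of \<open>G \<times> X\<close>, since
  \<open>g.x \<in> \<Prod>Z\<close> for some \<open>g\<close> can be tested, starting from any \<open>h\<close>
  with \<open>h.x\<^sub>k \<in> Z\<^sub>k\<close>, on the countably many \<open>g = l h\<close>
  with \<open>l\<close> a return time of \<open>Z\<^sub>k\<close>.\<close>

lemma simultaneous_returns_in_sets_borel_of:
  fixes G (structure)
  assumes "lcsc_group G T" and I: "finite I" "k \<in> I"
    and polish: "\<And>i. i \<in> I \<Longrightarrow> polish_space (X i)"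
    and action: "\<And>i. i \<in> I \<Longrightarrow> group_action G (topspace (X i)) (act i)"
    and cont: "\<And>i. i \<in> I \<Longrightarrow> continuous_map (prod_topology T (X i)) (X i) (\<lambda>(g, x). act i g x)"
    and cross: "\<And>i. i \<in> I \<Longrightarrow> cross_section G (act i) (borel_of (X i)) (Z i)"
    and countable: "countable (return_times G (act k) (Z k))"
  shows "simultaneous_returns G I X act Z \<in> sets (borel_of (product_topology X I))"
proof -
  interpret lcsc_group G T by fact
  interpret k: group_action G "topspace (X k)" "act k" using action I by blast
  define P where "P = product_topology X I"
  define Y where "Y = prod_topology T P"
  \<comment> \<open>A point of \<open>Y\<close> is a pair \<open>(h, x)\<close>, and the test is
    made at the time \<open>g \<otimes> h\<close>; for \<open>g = \<one>\<close> it concerns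
    \<open>h\<close> itself.\<close>
  define ret where "ret i g = {y \<in> topspace Y. act i (g \<otimes> fst y) (snd y i) \<in> Z i}" for i g
  have ret_sets: "ret i g \<in> sets (borel_of Y)" if "i \<in> I" "g \<in> carrier G" for i g
  proof -
    have "continuous_map Y T (\<lambda>y. g \<otimes> fst y)"
      unfolding Y_def using that
      by (intro continuous_map_group_mult continuous_map_fst) (simp add: topspace_carrier)
    moreover have "continuous_map Y (X i) (\<lambda>y. snd y i)"
      unfolding Y_def P_def
      using continuous_map_compose[OF continuous_map_snd continuous_map_product_projection[OF that(1)]]
      by (simp add: o_def)
    ultimately have "continuous_map Y (prod_topology T (X i)) (\<lambda>y. (g \<otimes> fst y, snd y i))"
      by (simp add: continuous_map_paired)
    from continuous_map_compose[OF this cont[OF that(1)]]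
    have "continuous_map Y (X i) (\<lambda>y. act i (g \<otimes> fst y) (snd y i))"
      by (simp add: o_def)
    then have "(\<lambda>y. act i (g \<otimes> fst y) (snd y i)) -` Z i \<inter> space (borel_of Y) \<in> sets (borel_of Y)"
      using cross[OF that(1)] by (intro measurable_sets[OF continuous_map_imp_measurable]) (auto simp: cross_section_def)
    also have "(\<lambda>y. act i (g \<otimes> fst y) (snd y i)) -` Z i \<inter> space (borel_of Y) = ret i g"
      by (auto simp: ret_def)
    finally show ?thesis .
  qed
  have all_sets: "(\<Inter>i\<in>I. ret i g) \<in> sets (borel_of Y)" if "g \<in> carrier G" for g
    using I ret_sets that by (intro sets.finite_INT) auto
  define L where "L = return_times G (act k) (Z k)"
  have L: "l \<in> carrier G" if "l \<in> L" for l using that by (simp add: L_def return_times_def)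
  define A where "A = (\<Inter>i\<in>I. ret i \<one>)"
  \<comment> \<open>Here \<open>h\<close> already moves \<open>x k\<close> into \<open>Z k\<close>,
    so any simultaneous time has the form \<open>l \<otimes> h\<close> with \<open>l\<close> in
    \<open>L\<close>; \<open>B\<close> rejects all of these.\<close>
  define B where "B = ret k \<one> - (\<Union>l\<in>L. \<Inter>i\<in>I. ret i l)"
  have topY: "y \<in> topspace Y \<longleftrightarrow> fst y \<in> carrier G \<and> snd y \<in> topspace P" for y
    by (cases y) (simp add: Y_def topspace_carrier)
  have A_iff: "y \<in> A \<longleftrightarrow> y \<in> topspace Y \<and> (\<forall>i\<in>I. act i (fst y) (snd y i) \<in> Z i)" for y
    using I(2) by (auto simp: A_def ret_def topY)
  have proj_A: "snd ` A = simultaneous_returns G I X act Z"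
  proof (intro equalityI subsetI)
    fix x assume "x \<in> snd ` A"
    then obtain g where "(g, x) \<in> A" by auto
    then show "x \<in> simultaneous_returns G I X act Z"
      by (auto simp: simultaneous_returns_def A_iff topY P_def intro!: bexI[of _ g])
  next
    fix x assume "x \<in> simultaneous_returns G I X act Z"
    then obtain g where "g \<in> carrier G" "x \<in> topspace P" "\<forall>i\<in>I. act i g (x i) \<in> Z i"
      unfolding simultaneous_returns_def P_def by blast
    then have "(g, x) \<in> A" by (simp add: A_iff topY)
    then show "x \<in> snd ` A" by force
  qed
  have proj_B: "snd ` B = topspace P - simultaneous_returns G I X act Z"
  proof (intro equalityI subsetI)
    fix x assume "x \<in> snd ` B"
    then obtain h where h: "(h, x) \<in> B" by auto
    then have hx: "h \<in> carrier G" "x \<in> topspace P" "act k h (x k) \<in> Z k"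
      by (auto simp: B_def ret_def topY)
    have "x \<notin> simultaneous_returns G I X act Z"
    proof
      assume "x \<in> simultaneous_returns G I X act Z"
      then obtain g where g: "g \<in> carrier G" "\<And>i. i \<in> I \<Longrightarrow> act i g (x i) \<in> Z i"
        by (auto simp: simultaneous_returns_def)
      have "x k \<in> topspace (X k)" using hx(2) I(2) by (auto simp: P_def)
      then have "g \<otimes> inv h \<in> L"
        unfolding L_def using hx g I(2) by (intro k.return_times_transition) auto
      moreover have "(h, x) \<in> ret i (g \<otimes> inv h)" if "i \<in> I" for i
      proof -
        have "g \<otimes> inv h \<otimes> h = g" using g(1) hx(1) by (simp add: m_assoc)
        then show ?thesis using that g hx by (simp add: ret_def topY)
      qed
      ultimately show False using h by (auto simp: B_def)
    qed
    then show "x \<in> topspace P - simultaneous_returns G I X act Z" using hx by blast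
  next
    fix x assume x: "x \<in> topspace P - simultaneous_returns G I X act Z"
    then have "x k \<in> topspace (X k)" using I(2) by (auto simp: P_def)
    then have "x k \<in> (\<Union>h\<in>carrier G. act k h ` Z k)"
      using cross[OF I(2)] by (simp add: cross_section_def)
    then obtain g z where gz: "g \<in> carrier G" "z \<in> Z k" "x k = act k g z"
      by auto
    moreover have "z \<in> topspace (X k)"
      using gz(2) cross[OF I(2)] sets.sets_into_space[of "Z k" "borel_of (X k)"]
      unfolding cross_section_def by auto
    \<comment> \<open>The covering by translates of \<open>Z k\<close> is used through the inverse:
      \<open>inv g\<close> is the first component of the required point of \<open>B\<close>.\<close>
    ultimately have "act k (inv g) (x k) = z"
      using k.orbit_sym_aux by metis
    then have "(inv g, x) \<in> ret k \<one>"
      using x gz by (simp add: ret_def topY)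
    moreover have "(inv g, x) \<notin> (\<Inter>i\<in>I. ret i l)" if "l \<in> L" for l
    proof
      assume *: "(inv g, x) \<in> (\<Inter>i\<in>I. ret i l)"
      then have "\<forall>i\<in>I. act i (l \<otimes> inv g) (x i) \<in> Z i" by (simp add: ret_def)
      then have "x \<in> simultaneous_returns G I X act Z"
        unfolding simultaneous_returns_def using x L[OF that] gz(1)
        by (auto simp: P_def intro!: bexI[of _ "l \<otimes> inv g"])
      then show False using x by blast
    qed
    ultimately have "(inv g, x) \<in> B" by (auto simp: B_def)
    then show "x \<in> snd ` B" by force
  qed
  have "snd ` A \<in> sets (borel_of P)"
  proof (rule continuous_image_in_sets_borel_of[where Y = Y and B = B])
    have "polish_space P" unfolding P_def using I(1) polish by (rule polish_space_product_topology)
    then show "polish_space Y" "Hausdorff_space P"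
      unfolding Y_def by (auto intro: polish_space polish_space_prod_topology polish_space_imp_Hausdorff_space)
    show "continuous_map Y P snd" unfolding Y_def by (rule continuous_map_snd)
    show "A \<in> sets (borel_of Y)" unfolding A_def by (rule all_sets) simp
    have "(\<Union>l\<in>L. \<Inter>i\<in>I. ret i l) \<in> sets (borel_of Y)"
      using countable[folded L_def] L by (intro sets.countable_UN' image_subsetI all_sets) auto
    then show "B \<in> sets (borel_of Y)"
      unfolding B_def using ret_sets[OF I(2) one_closed] by blast
    show "snd ` A \<inter> snd ` B = {}" "snd ` A \<union> snd ` B = topspace P"
      unfolding proj_A proj_B by (auto simp: simultaneous_returns_def P_def)
  qed
  then show ?thesis by (simp only: proj_A P_def)
qed

section \<open>Conjugated return times and the proof of commensurability\<close>

text \<open>Since \<open>l \<otimes> h = inv \<kappa>\<close>, conjugation by the uncontrolled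
  \<open>h\<close> becomes conjugation by \<kappa>. In the application
  \<open>h \<otimes> n \<otimes> inv g\<close> is a return time for coordinate \<open>i\<close> and
  \<open>h \<otimes> inv g\<close> one for coordinate \<open>k\<close>, so the right side is a pair
  from the first set times a pair from the second.\<close>

lemma (in group) conjugate_return_time:
  assumes "g \<in> carrier G" "h \<in> carrier G" "n \<in> carrier G" "\<kappa> \<in> carrier G" "l \<in> carrier G"
    and h: "inv h = \<kappa> \<otimes> l"
  shows "inv \<kappa> \<otimes> n \<otimes> \<kappa> = l \<otimes> (h \<otimes> n \<otimes> inv g) \<otimes> (inv (h \<otimes> inv g) \<otimes> inv l)"
proof -
  have "h = inv (\<kappa> \<otimes> l)" using assms by (metis inv_inv)
  then have "l \<otimes> h = inv \<kappa>" using assms by (simp add: inv_mult_group m_assoc[symmetric])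
  moreover have "\<kappa> = inv h \<otimes> inv l" using assms by (simp add: m_assoc)
  moreover have "inv g \<otimes> (g \<otimes> z) = z" if "z \<in> carrier G" for z
    using assms(1) that by (simp add: m_assoc[symmetric])
  then have "l \<otimes> (h \<otimes> n \<otimes> inv g) \<otimes> (inv (h \<otimes> inv g) \<otimes> inv l) =
      (l \<otimes> h) \<otimes> n \<otimes> (inv g \<otimes> g) \<otimes> (inv h \<otimes> inv l)"
    using assms(1-5) by (simp add: inv_mult_group m_assoc)
  ultimately show ?thesis using assms(1-5) by simp
qed

text \<open>A trailing \<open>\<one>\<close> turns each pair into a threefold product.\<close>

lemma (in monoid) mult4_in_cubes:
  assumes "A \<subseteq> carrier G" "B \<subseteq> carrier G" "\<one> \<in> A" "\<one> \<in> B"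
    and "a \<in> A" "a' \<in> A" "b \<in> B" "b' \<in> B"
  shows "a \<otimes> a' \<otimes> (b \<otimes> b') \<in> (A <#> A <#> A) <#> (B <#> B <#> B)"
proof -
  have "a \<otimes> a' \<otimes> \<one> \<in> A <#> A <#> A" "b \<otimes> b' \<otimes> \<one> \<in> B <#> B <#> B"
    using assms by (auto simp: set_mult_def)
  moreover have "a \<otimes> a' \<in> carrier G" "b \<otimes> b' \<in> carrier G" using assms by auto
  ultimately have "a \<otimes> a' \<in> A <#> A <#> A" "b \<otimes> b' \<in> B <#> B <#> B" by auto
  then show ?thesis unfolding set_mult_def[of G "A <#> A <#> A"] by blast
qed

lemma coordinate_kernel_iff:
  "n \<in> coordinate_kernel G I k \<longleftrightarrow> n \<in> (\<Pi>\<^sub>E i\<in>I. carrier G) \<and> n k = \<one>\<^bsub>G\<^esub>"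
  by (simp add: coordinate_kernel_def kernel_def)

theorem theorem1p9:
  fixes G :: "('g, 'm) monoid_scheme" (structure)
    and T :: "'g topology"
    and r :: nat
    and X :: "nat \<Rightarrow> 'x topology"
    and act :: "nat \<Rightarrow> 'g \<Rightarrow> 'x \<Rightarrow> 'x"
    and Z :: "nat \<Rightarrow> 'x set"
    and \<Lambda> :: "nat \<Rightarrow> 'g set"
  assumes "lcsc_group G T"
    and "unimodular G T"
    and "r \<ge> 1"
    and "\<And>i. i \<in> {1..r} \<Longrightarrow> polish_space (X i)"
    and "\<And>i. i \<in> {1..r} \<Longrightarrow> group_action G (topspace (X i)) (act i)"
    and "\<And>i. i \<in> {1..r} \<Longrightarrow>
           continuous_map (prod_topology T (X i)) (X i) (\<lambda>(g, x). act i g x)"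
    and "\<And>i. i \<in> {1..r} \<Longrightarrow> separated_cross_section G T (act i) (borel_of (X i)) (Z i)"
    and "\<And>i. i \<in> {1..r} \<Longrightarrow> \<Lambda> i = return_times G (act i) (Z i)"
    and "relatively_dense G T (\<Inter>i\<in>{1..r}. \<Lambda> i)"
    and "\<And>i j. i \<in> {1..r} \<Longrightarrow> j \<in> {1..r} \<Longrightarrow>
           \<not> accumulates_at_one G T
               ((\<Lambda> i <#> \<Lambda> i <#> \<Lambda> i) <#> (\<Lambda> j <#> \<Lambda> j <#> \<Lambda> j))"
  shows "commensurable G T {1..r} X act Z"
proof -
  interpret lcsc_group G T by fact
  define I where "I = {1..r}"
  have I: "finite I" "I \<noteq> {}" using assms(3) by (auto simp: I_def)
  note polish = assms(4)[folded I_def] and action = assms(5)[folded I_def]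
    and cont = assms(6)[folded I_def] and \<Lambda>_eq = assms(8)[folded I_def]
    and dense = assms(9)[folded I_def] and no_acc = assms(10)[folded I_def]
  have cross: "cross_section G (act i) (borel_of (X i)) (Z i)" if "i \<in> I" for i
    using assms(7)[folded I_def, OF that] by (simp add: separated_cross_section_def)
  have Z_sub: "Z i \<subseteq> topspace (X i)" if "i \<in> I" for i
    using cross[OF that] sets.sets_into_space[of "Z i" "borel_of (X i)"] by (simp add: cross_section_def)
  have \<Lambda>_sub: "\<Lambda> i \<subseteq> carrier G" if "i \<in> I" for i
    using \<Lambda>_eq[OF that] by (auto simp: return_times_def)
  obtain K where K: "compactin T K" "carrier G = K <#> (\<Inter>i\<in>I. \<Lambda> i)"
    using dense unfolding relatively_dense_def by auto
  \<comment> \<open>The identity too factors through \<open>K\<close> and the common return times,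
    so these exist and no \<open>Z i\<close> is empty.\<close>
  have \<Lambda>_one: "\<one> \<in> \<Lambda> i" if "i \<in> I" for i
  proof -
    have "\<one> \<in> K <#> (\<Inter>i\<in>I. \<Lambda> i)" using K(2) one_closed by simp
    then have "\<Lambda> i \<noteq> {}" using that by (auto simp: set_mult_def)
    then have "Z i \<noteq> {}" using \<Lambda>_eq[OF that] by (auto simp: return_times_def)
    then show ?thesis
      using group_action.one_in_return_times[OF action[OF that] Z_sub[OF that]] \<Lambda>_eq[OF that] by simp
  qed
  have \<Lambda>_inv: "inv a \<in> \<Lambda> i" if "i \<in> I" "a \<in> \<Lambda> i" for a i
    using group_action.return_times_inv[OF action Z_sub] \<Lambda>_eq that by simp
  have countable: "countable (\<Lambda> i)" if "i \<in> I" for i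
  proof (rule not_accumulates_imp_countable[OF \<Lambda>_sub[OF that] \<Lambda>_inv[OF that]])
    \<comment> \<open>The hypothesis on cubes is used with \<open>j = i\<close>, the second cube
      contributing only \<open>\<one>\<close>.\<close>
    have "\<Lambda> i <#> \<Lambda> i \<subseteq> (\<Lambda> i <#> \<Lambda> i <#> \<Lambda> i) <#> (\<Lambda> i <#> \<Lambda> i <#> \<Lambda> i)"
    proof
      fix x assume "x \<in> \<Lambda> i <#> \<Lambda> i"
      then obtain a b where ab: "a \<in> \<Lambda> i" "b \<in> \<Lambda> i" "x = a \<otimes> b" by (auto simp: set_mult_def)
      then have "a \<otimes> b \<otimes> (\<one> \<otimes> \<one>) = x" using \<Lambda>_sub[OF that] by (simp add: subset_iff)
      then show "x \<in> (\<Lambda> i <#> \<Lambda> i <#> \<Lambda> i) <#> (\<Lambda> i <#> \<Lambda> i <#> \<Lambda> i)"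
        using mult4_in_cubes[OF \<Lambda>_sub \<Lambda>_sub \<Lambda>_one \<Lambda>_one ab(1,2) \<Lambda>_one \<Lambda>_one] that by simp
    qed
    then show "\<not> accumulates_at_one G T (\<Lambda> i <#> \<Lambda> i)"
      using no_acc[OF that that] accumulates_at_one_mono by blast
  qed
  define S where "S = simultaneous_returns G I X act Z"
  define E where "E = (\<Pi>\<^sub>E i\<in>I. topspace (X i))"
  have S_iff: "x \<in> S \<longleftrightarrow> x \<in> E \<and> (\<exists>g\<in>carrier G. \<forall>i\<in>I. act i g (x i) \<in> Z i)" for x
    by (simp add: S_def E_def simultaneous_returns_def)
  let ?act = "product_action I (\<lambda>i. topspace (X i)) act"
  have act_eq: "?act n x = (\<lambda>i\<in>I. act i (n i) (x i))" if "x \<in> E" for n x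
    using that by (simp add: product_action_def E_def)
  have act_closed: "act i g x \<in> topspace (X i)" if "i \<in> I" "g \<in> carrier G" "x \<in> topspace (X i)" for i g x
    using group_action.element_image[OF action[OF that(1)] that(2,3)] by simp
  have act_mult: "act i h (act i g x) = act i (h \<otimes> g) x"
    if "i \<in> I" "h \<in> carrier G" "g \<in> carrier G" "x \<in> topspace (X i)" for i g h x
    using group_action.composition_rule[OF action[OF that(1)] that(4,2,3)] by simp
  show ?thesis
    unfolding commensurable_def I_def[symmetric]
  proof
    fix k assume k: "k \<in> I"
    define N where "N = coordinate_kernel G I k"
    let ?H = "(product_group I (\<lambda>_. G))\<lparr>carrier := N\<rparr>"
    have N_iff: "n \<in> N \<longleftrightarrow> n \<in> (\<Pi>\<^sub>E i\<in>I. carrier G) \<and> n k = \<one>" for n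
      by (simp add: N_def coordinate_kernel_iff)
    have "S \<in> sets (borel_of (product_topology X I))"
      unfolding S_def
      using simultaneous_returns_in_sets_borel_of[OF assms(1) I(1) k polish action cont cross]
        countable[OF k] \<Lambda>_eq[OF k] by simp
    moreover have "(\<Union>n\<in>N. ?act n ` S) = E"
    proof (intro equalityI subsetI)
      fix y assume "y \<in> (\<Union>n\<in>N. ?act n ` S)"
      then obtain n x where n: "n \<in> N" "x \<in> S" "y = ?act n x" by auto
      then have "x \<in> E" by (simp add: S_iff)
      then have "act i (n i) (x i) \<in> topspace (X i)" if "i \<in> I" for i
        using that n(1) by (intro act_closed) (auto simp: N_iff E_def)
      then show "y \<in> E" unfolding n(3) act_eq[OF \<open>x \<in> E\<close>] by (auto simp: E_def)
    next
      fix x assume x: "x \<in> E"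
      have "\<forall>i\<in>I. \<exists>g. g \<in> carrier G \<and> act i g (x i) \<in> Z i"
      proof
        fix i assume i: "i \<in> I"
        then have "x i \<in> (\<Union>h\<in>carrier G. act i h ` Z i)"
          using cross[OF i] x by (auto simp: cross_section_def E_def)
        then obtain h z where h: "h \<in> carrier G" "z \<in> Z i" "x i = act i h z" by auto
        then have "act i (inv h) (x i) = z"
          using group_action.orbit_sym_aux[OF action[OF i] h(1), of z "x i"] Z_sub[OF i] by auto
        then show "\<exists>g. g \<in> carrier G \<and> act i g (x i) \<in> Z i" using h by auto
      qed
      from bchoice[OF this] obtain g where g: "\<forall>i\<in>I. g i \<in> carrier G \<and> act i (g i) (x i) \<in> Z i" ..
      \<comment> \<open>Dividing by \<open>g k\<close> makes component \<open>k\<close> trivial,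
        while \<open>g k\<close> becomes a common time for all coordinates of the translate
        \<open>y\<close> of \<open>x\<close>. So \<open>y\<close> lies in \<open>S\<close>, and the
        inverse of \<open>m\<close> leads back to \<open>x\<close>.\<close>
      define m where "m = (\<lambda>i\<in>I. inv (g k) \<otimes> g i)"
      have m: "m i \<in> carrier G" "act i (g k) (act i (m i) (x i)) \<in> Z i" if "i \<in> I" for i
      proof -
        show "m i \<in> carrier G" using g that k by (simp add: m_def)
        have "x i \<in> topspace (X i)" using x that by (auto simp: E_def)
        then have "act i (g k) (act i (m i) (x i)) = act i (g k \<otimes> (inv (g k) \<otimes> g i)) (x i)"
          using that k g by (subst act_mult) (auto simp: m_def)
        also have "g k \<otimes> (inv (g k) \<otimes> g i) = g i"
          using g that k by (simp add: m_assoc[symmetric])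
        finally show "act i (g k) (act i (m i) (x i)) \<in> Z i" using g that by simp
      qed
      define y where "y = ?act m x"
      have y: "y i = act i (m i) (x i)" if "i \<in> I" for i
        using that by (simp add: y_def act_eq[OF x])
      have y_top: "y i \<in> topspace (X i)" if "i \<in> I" for i
        unfolding y[OF that] using that m x by (intro act_closed) (auto simp: E_def)
      have "y \<in> E"
        using y_top unfolding E_def y_def act_eq[OF x] by auto
      then have "y \<in> S"
        unfolding S_iff using g k m(2) y by (intro conjI bexI[of _ "g k"]) auto
      define n where "n = (\<lambda>i\<in>I. inv (m i))"
      have "m k = \<one>" using g k by (simp add: m_def)
      then have "n \<in> N" using m k by (auto simp: N_iff n_def)
      moreover have "?act n y = x"
      proof
        fix i
        show "?act n y i = x i"
        proof (cases "i \<in> I")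
          case True
          have "act i (inv (m i)) (y i) = x i"
            using group_action.orbit_sym_aux[OF action[OF True] m(1)[OF True], of "x i" "y i"] y[OF True] True x
            by (auto simp: E_def)
          then show ?thesis using True by (simp add: act_eq[OF \<open>y \<in> E\<close>] n_def)
        next
          case False
          then show ?thesis using x by (auto simp: act_eq[OF \<open>y \<in> E\<close>] E_def PiE_def extensional_def)
        qed
      qed
      ultimately show "x \<in> (\<Union>n\<in>N. ?act n ` S)" using \<open>y \<in> S\<close> by force
    qed
    moreover have "\<not> accumulates_at_one ?H (subtopology (product_topology (\<lambda>_. T) I) N) (return_times ?H ?act S)"
    proof -
      \<comment> \<open>The conjugating \<kappa> will depend on the return time under test, so
        \<open>W\<close> has to work for all of \<open>K\<close> at once.\<close>
      have "\<exists>W. openin T W \<and> \<one> \<in> W \<and> (\<forall>\<kappa>\<in>K. \<forall>w\<in>W. inv \<kappa> \<otimes> w \<otimes> \<kappa> \<in>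
          (\<Lambda> i <#> \<Lambda> i <#> \<Lambda> i) <#> (\<Lambda> k <#> \<Lambda> k <#> \<Lambda> k) \<longrightarrow> inv \<kappa> \<otimes> w \<otimes> \<kappa> = \<one>)" if i: "i \<in> I" for i
      proof -
        obtain U where U: "openin T U" "\<one> \<in> U"
          "((\<Lambda> i <#> \<Lambda> i <#> \<Lambda> i) <#> (\<Lambda> k <#> \<Lambda> k <#> \<Lambda> k)) \<inter> U \<subseteq> {\<one>}"
          using no_acc[OF i k] unfolding accumulates_at_one_def by auto
        obtain W where "openin T W" "\<one> \<in> W" "\<And>\<kappa> w. \<kappa> \<in> K \<Longrightarrow> w \<in> W \<Longrightarrow> inv \<kappa> \<otimes> w \<otimes> \<kappa> \<in> U"
          by (rule open_conjugation_compact[OF K(1) U(1,2)]) blast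
        with U(3) show ?thesis by (intro exI[of _ W]) auto
      qed
      then obtain W where W: "\<forall>i\<in>I. openin T (W i) \<and> \<one> \<in> W i \<and> (\<forall>\<kappa>\<in>K. \<forall>w\<in>W i. inv \<kappa> \<otimes> w \<otimes> \<kappa> \<in>
          (\<Lambda> i <#> \<Lambda> i <#> \<Lambda> i) <#> (\<Lambda> k <#> \<Lambda> k <#> \<Lambda> k) \<longrightarrow> inv \<kappa> \<otimes> w \<otimes> \<kappa> = \<one>)"
        using bchoice[of I] by metis
      define V where "V = N \<inter> (\<Pi>\<^sub>E i\<in>I. W i)"
      have one_H: "\<one>\<^bsub>?H\<^esub> = (\<lambda>i\<in>I. \<one>)" by simp
      have "openin (product_topology (\<lambda>_. T) I) (\<Pi>\<^sub>E i\<in>I. W i)"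
        using W I(1) by (simp add: openin_PiE_gen)
      then have "openin (subtopology (product_topology (\<lambda>_. T) I) N) V"
        unfolding V_def by (rule openin_subtopology_Int2)
      moreover have "\<one>\<^bsub>?H\<^esub> \<in> V"
        unfolding one_H using W k by (auto simp: V_def N_iff)
      moreover have "n = \<one>\<^bsub>?H\<^esub>" if n: "n \<in> return_times ?H ?act S" "n \<in> V" for n
      proof -
        have "n \<in> N" using n(2) by (simp add: V_def)
        then have nG: "n i \<in> carrier G" if "i \<in> I" for i using that by (auto simp: N_iff)
        have nk: "n k = \<one>" using \<open>n \<in> N\<close> by (simp add: N_iff)
        obtain x where x: "x \<in> S" "?act n x \<in> S"
          using n(1) by (auto simp: return_times_def)
        then have "x \<in> E" by (simp add: S_iff)
        then have xi: "x i \<in> topspace (X i)" if "i \<in> I" for i using that by (auto simp: E_def)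
        obtain g where g: "g \<in> carrier G" "\<And>i. i \<in> I \<Longrightarrow> act i g (x i) \<in> Z i"
          using x(1) by (auto simp: S_iff)
        obtain h where h: "h \<in> carrier G" "\<And>i. i \<in> I \<Longrightarrow> act i h (?act n x i) \<in> Z i"
          using x(2) by (auto simp: S_iff)
        \<comment> \<open>In coordinate \<open>i\<close>, both \<open>g\<close> and
          \<open>h \<otimes> n i\<close> are times at which \<open>x i\<close> visits
          \<open>Z i\<close>.\<close>
        have trans: "h \<otimes> n i \<otimes> inv g \<in> \<Lambda> i" if i: "i \<in> I" for i
        proof -
          have "act i (h \<otimes> n i) (x i) = act i h (?act n x i)"
            using i h(1) nG xi by (simp add: act_eq[OF \<open>x \<in> E\<close>] act_mult)
          then have "act i (h \<otimes> n i) (x i) \<in> Z i" using h(2)[OF i] by simp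
          then show ?thesis
            unfolding \<Lambda>_eq[OF i] using g h(1) nG i xi
            by (intro group_action.return_times_transition[OF action[OF i], of "x i"]) auto
        qed
        \<comment> \<open>Relative density enters here: \<open>h\<close> is arbitrary, but up to a
          compact factor its inverse is a return time common to all coordinates, so \<open>l\<close>
          is absorbed on the side of \<open>i\<close> and \<open>inv l\<close> on the side of
          \<open>k\<close>.\<close>
        have "inv h \<in> K <#> (\<Inter>i\<in>I. \<Lambda> i)" using K(2) h(1) by auto
        then obtain \<kappa> l where \<kappa>: "\<kappa> \<in> K" "inv h = \<kappa> \<otimes> l" and l: "\<And>i. i \<in> I \<Longrightarrow> l \<in> \<Lambda> i"
          by (auto simp: set_mult_def)
        have \<kappa>G: "\<kappa> \<in> carrier G"
          using \<kappa>(1) compactin_subset_topspace[OF K(1)] by (auto simp: topspace_carrier)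
        have lG: "l \<in> carrier G" using l[OF k] \<Lambda>_sub[OF k] by auto
        \<comment> \<open>Coordinate \<open>k\<close> does not see \<open>n\<close>, which relates
          \<open>h\<close> to \<open>g\<close> independently of \<open>i\<close>.\<close>
        have hg: "h \<otimes> inv g \<in> \<Lambda> k" using trans[OF k] nk h(1) by simp
        have "n i = \<one>" if i: "i \<in> I" for i
        proof -
          have "inv \<kappa> \<otimes> n i \<otimes> \<kappa> = l \<otimes> (h \<otimes> n i \<otimes> inv g) \<otimes> (inv (h \<otimes> inv g) \<otimes> inv l)"
            by (rule conjugate_return_time[OF g(1) h(1) nG[OF i] \<kappa>G lG \<kappa>(2)])
          also have "\<dots> \<in> (\<Lambda> i <#> \<Lambda> i <#> \<Lambda> i) <#> (\<Lambda> k <#> \<Lambda> k <#> \<Lambda> k)"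
            by (intro mult4_in_cubes \<Lambda>_sub \<Lambda>_one l trans \<Lambda>_inv hg i k)
          finally have "inv \<kappa> \<otimes> n i \<otimes> \<kappa> = \<one>"
            using W i \<kappa>(1) n(2) by (auto simp: V_def PiE_iff)
          then have "inv \<kappa> = inv \<kappa> \<otimes> n i"
            using \<kappa>G nG[OF i] by (intro inv_equality) auto
          then show ?thesis
            using \<kappa>G nG[OF i] l_cancel_one[of "inv \<kappa>" "n i"] by auto
        qed
        then show ?thesis
          unfolding one_H using \<open>n \<in> N\<close> by (auto simp: N_iff PiE_def extensional_def fun_eq_iff)
      qed
      ultimately show ?thesis
        unfolding accumulates_at_one_def by blast
    qed
    ultimately show "separated_cross_section ((product_group I (\<lambda>_. G))\<lparr>carrier := coordinate_kernel G I k\<rparr>)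
      (subtopology (product_topology (\<lambda>_. T) I) (coordinate_kernel G I k)) ?act
      (borel_of (product_topology X I)) (simultaneous_returns G I X act Z)"
      by (simp add: separated_cross_section_def cross_section_def N_def S_def E_def)
  qed
qed

end
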